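(* Let $\Omega$ be a set with four binary operations $\leftarrow,\rightarrow,\lhd,\rhd$ and let $(A,(P_\omega)_{\omega\in\Omega})$ be an $\Omega$-Rota-Baxter algebra of weight $0$. Then $(A,(\prec_\omega)_{\omega\in\Omega},(\succ_\omega)_{\omega\in\Omega})$ is an $\Omega$-dendriform algebra, where, for all $a,b\in A$ and $\omega\in\Omega$, $$a\prec_\omega b:=aP_\omega(b),\qquad a\succ_\omega b:=P_\omega(a)b.$$
   Context: $\mathbf{k}$ is a unitary commutative ring, the base ring of all modules, algebras and linear maps. For a set $\Omega$ with four binary operations $\leftarrow,\rightarrow,\lhd,\rhd:\Omega\times\Omega\to\Omega$, an $\Omega$-Rota-Baxter algebra of weight $0$ is a pair $(A,(P_\omega)_{\omega\in\Omega})$ where $A$ is an associative algebra and each $P_\omega:A\to A$ is a linear map, such that for all $a,b\in A$ and $\alpha,\beta\in\Omega$: $$P_\alpha(a)P_\beta(b)=P_{\alpha\rightarrow\beta}(P_{\alpha\rhd\beta}(a)b)+P_{\alpha\leftarrow\beta}(aP_{\alpha\lhd\beta}(b)).$$ An $\Omega$-dendriform algebra is a module $A$ with two families of bilinear products $\prec_\omega,\succ_\omega:A\otimes A\to A$ ($\omega\in\Omega$) such that for all $a,b,c\in A$ and $\alpha,\beta\in\Omega$: $(a\prec_\alpha b)\prec_\beta c=a\prec_{\alpha\leftarrow\beta}(b\prec_{\alpha\lhd\beta}c)+a\prec_{\alpha\rightarrow\beta}(b\succ_{\alpha\rhd\beta}c)$; $a\succ_\alpha(b\prec_\beta c)=(a\succ_\alpha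 b)\prec_\beta c$; $a\succ_\alpha(b\succ_\beta c)=(a\succ_{\alpha\rhd\beta}b)\succ_{\alpha\rightarrow\beta}c+(a\prec_{\alpha\lhd\beta}b)\succ_{\alpha\leftarrow\beta}c$. *)

theory Defs
  imports "HOL-Algebra.Module"
begin

definition linear_map ::
  "('k, 'm) ring_scheme \<Rightarrow> ('k, 'a, 'n) module_scheme \<Rightarrow> ('k, 'b, 'p) module_scheme \<Rightarrow> ('a \<Rightarrow> 'b) \<Rightarrow> bool"
  where "linear_map K M N f \<longleftrightarrow>
    f \<in> carrier M \<rightarrow> carrier N \<and>
    (\<forall>x\<in>carrier M. \<forall>y\<in>carrier M. f (x \<oplus>\<^bsub>M\<^esub> y) = f x \<oplus>\<^bsub>N\<^esub> f y) \<and>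
    (\<forall>c\<in>carrier K. \<forall>x\<in>carrier M. f (c \<odot>\<^bsub>M\<^esub> x) = c \<odot>\<^bsub>N\<^esub> f x)"

definition bilinear_product ::
  "('k, 'm) ring_scheme \<Rightarrow> ('k, 'a, 'n) module_scheme \<Rightarrow> ('a \<Rightarrow> 'a \<Rightarrow> 'a) \<Rightarrow> bool"
  where "bilinear_product K M f \<longleftrightarrow>
    (\<forall>a\<in>carrier M. linear_map K M M (\<lambda>b. f a b)) \<and>
    (\<forall>b\<in>carrier M. linear_map K M M (\<lambda>a. f a b))"

text \<open>The library's locale \<^locale>\<open>algebra\<close> is for commutative unital algebras.  Here the product
  is only associative: neither commutativity nor a unit is required, and the field \<^const>\<open>one\<close> of
  the record \<open>A\<close> is unconstrained.\<close>

locale associative_algebra = module K A for K (structure) and A (structure) +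
  assumes mult_bilinear: "bilinear_product K A (\<lambda>a b. a \<otimes>\<^bsub>A\<^esub> b)"
    and mult_assoc:
      "\<lbrakk>a \<in> carrier A; b \<in> carrier A; c \<in> carrier A\<rbrakk>
        \<Longrightarrow> (a \<otimes>\<^bsub>A\<^esub> b) \<otimes>\<^bsub>A\<^esub> c = a \<otimes>\<^bsub>A\<^esub> (b \<otimes>\<^bsub>A\<^esub> c)"

text \<open>The four operations are written in bold, since the plain arrows and triangles
  already have a meaning in the library (function sets, normal subgroups).  The set \<open>\<Omega>\<close> may be
  empty, and no axioms relate the operations.\<close>

locale four_operations =
  fixes \<Omega> :: "'w set"
    and larrow :: "'w \<Rightarrow> 'w \<Rightarrow> 'w" (infixl \<open>\<^bold>\<leftarrow>\<close> 70)
    and rarrow :: "'w \<Rightarrow> 'w \<Rightarrow> 'w" (infixl \<open>\<^bold>\<rightarrow>\<close> 70)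
    and ltri :: "'w \<Rightarrow> 'w \<Rightarrow> 'w" (infixl \<open>\<^bold>\<lhd>\<close> 70)
    and rtri :: "'w \<Rightarrow> 'w \<Rightarrow> 'w" (infixl \<open>\<^bold>\<rhd>\<close> 70)
  assumes larrow_closed: "\<lbrakk>\<alpha> \<in> \<Omega>; \<beta> \<in> \<Omega>\<rbrakk> \<Longrightarrow> \<alpha> \<^bold>\<leftarrow> \<beta> \<in> \<Omega>"
    and rarrow_closed: "\<lbrakk>\<alpha> \<in> \<Omega>; \<beta> \<in> \<Omega>\<rbrakk> \<Longrightarrow> \<alpha> \<^bold>\<rightarrow> \<beta> \<in> \<Omega>"
    and ltri_closed: "\<lbrakk>\<alpha> \<in> \<Omega>; \<beta> \<in> \<Omega>\<rbrakk> \<Longrightarrow> \<alpha> \<^bold>\<lhd> \<beta> \<in> \<Omega>"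
    and rtri_closed: "\<lbrakk>\<alpha> \<in> \<Omega>; \<beta> \<in> \<Omega>\<rbrakk> \<Longrightarrow> \<alpha> \<^bold>\<rhd> \<beta> \<in> \<Omega>"

locale Omega_Rota_Baxter_algebra = associative_algebra K A + four_operations \<Omega> larrow rarrow ltri rtri
  for K (structure) and A (structure)
    and \<Omega> :: "'w set"
    and larrow (infixl \<open>\<^bold>\<leftarrow>\<close> 70)
    and rarrow (infixl \<open>\<^bold>\<rightarrow>\<close> 70)
    and ltri (infixl \<open>\<^bold>\<lhd>\<close> 70)
    and rtri (infixl \<open>\<^bold>\<rhd>\<close> 70) +
  fixes P
  assumes P_linear: "\<omega> \<in> \<Omega> \<Longrightarrow> linear_map K A A (P \<omega>)"
    and Rota_Baxter:
      "\<lbrakk>\<alpha> \<in> \<Omega>; \<beta> \<in> \<Omega>; a \<in> carrier A; b \<in> carrier A\<rbrakk> \<Longrightarrow>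
        P \<alpha> a \<otimes>\<^bsub>A\<^esub> P \<beta> b =
          P (\<alpha> \<^bold>\<rightarrow> \<beta>) (P (\<alpha> \<^bold>\<rhd> \<beta>) a \<otimes>\<^bsub>A\<^esub> b)
          \<oplus>\<^bsub>A\<^esub> P (\<alpha> \<^bold>\<leftarrow> \<beta>) (a \<otimes>\<^bsub>A\<^esub> P (\<alpha> \<^bold>\<lhd> \<beta>) b)"

text \<open>\<open>prec \<omega> a b\<close> and \<open>succ \<omega> a b\<close> stand for $a \prec_\omega b$ and $a \succ_\omega b$.  Only the
  module part of the record \<open>A\<close> is used, not its multiplication.\<close>

locale Omega_dendriform_algebra = module K A + four_operations \<Omega> larrow rarrow ltri rtri
  for K (structure) and A (structure)
    and \<Omega> :: "'w set"
    and larrow (infixl \<open>\<^bold>\<leftarrow>\<close> 70)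
    and rarrow (infixl \<open>\<^bold>\<rightarrow>\<close> 70)
    and ltri (infixl \<open>\<^bold>\<lhd>\<close> 70)
    and rtri (infixl \<open>\<^bold>\<rhd>\<close> 70) +
  fixes prec and succ
  assumes prec_bilinear: "\<omega> \<in> \<Omega> \<Longrightarrow> bilinear_product K A (prec \<omega>)"
    and succ_bilinear: "\<omega> \<in> \<Omega> \<Longrightarrow> bilinear_product K A (succ \<omega>)"
    and prec_prec:
      "\<lbrakk>\<alpha> \<in> \<Omega>; \<beta> \<in> \<Omega>; a \<in> carrier A; b \<in> carrier A; c \<in> carrier A\<rbrakk> \<Longrightarrow>
        prec \<beta> (prec \<alpha> a b) c =
          prec (\<alpha> \<^bold>\<leftarrow> \<beta>) a (prec (\<alpha> \<^bold>\<lhd> \<beta>) b c)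
          \<oplus>\<^bsub>A\<^esub> prec (\<alpha> \<^bold>\<rightarrow> \<beta>) a (succ (\<alpha> \<^bold>\<rhd> \<beta>) b c)"
    and succ_prec:
      "\<lbrakk>\<alpha> \<in> \<Omega>; \<beta> \<in> \<Omega>; a \<in> carrier A; b \<in> carrier A; c \<in> carrier A\<rbrakk> \<Longrightarrow>
        succ \<alpha> a (prec \<beta> b c) = prec \<beta> (succ \<alpha> a b) c"
    and succ_succ:
      "\<lbrakk>\<alpha> \<in> \<Omega>; \<beta> \<in> \<Omega>; a \<in> carrier A; b \<in> carrier A; c \<in> carrier A\<rbrakk> \<Longrightarrow>
        succ \<alpha> a (succ \<beta> b c) =
          succ (\<alpha> \<^bold>\<rightarrow> \<beta>) (succ (\<alpha> \<^bold>\<rhd> \<beta>) a b) c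
          \<oplus>\<^bsub>A\<^esub> succ (\<alpha> \<^bold>\<leftarrow> \<beta>) (prec (\<alpha> \<^bold>\<lhd> \<beta>) a b) c"

end

theory Submission
  imports Defs
begin

lemma linear_map_compose:
  assumes "linear_map K L M f" and "linear_map K M N g"
  shows "linear_map K L N (\<lambda>x. g (f x))"
  using assms by (auto simp: linear_map_def Pi_iff)

context associative_algebra
begin

lemma
  assumes "a \<in> carrier A"
  shows linear_map_mult_left: "linear_map K A A (\<lambda>b. a \<otimes>\<^bsub>A\<^esub> b)"
    and linear_map_mult_right: "linear_map K A A (\<lambda>b. b \<otimes>\<^bsub>A\<^esub> a)"
  using mult_bilinear assms unfolding bilinear_product_def by auto

text \<open>Closure is contained in bilinearity: a linear map sends the carrier of its source into
  the carrier of its target.\<close>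

lemma alg_mult_closed:
  "\<lbrakk>a \<in> carrier A; b \<in> carrier A\<rbrakk> \<Longrightarrow> a \<otimes>\<^bsub>A\<^esub> b \<in> carrier A"
  using linear_map_mult_left unfolding linear_map_def by blast

lemma alg_distrib_left:
  "\<lbrakk>a \<in> carrier A; b \<in> carrier A; c \<in> carrier A\<rbrakk> \<Longrightarrow>
    a \<otimes>\<^bsub>A\<^esub> (b \<oplus>\<^bsub>A\<^esub> c) = a \<otimes>\<^bsub>A\<^esub> b \<oplus>\<^bsub>A\<^esub> a \<otimes>\<^bsub>A\<^esub> c"
  using linear_map_mult_left unfolding linear_map_def by blast

lemma alg_distrib_right:
  "\<lbrakk>a \<in> carrier A; b \<in> carrier A; c \<in> carrier A\<rbrakk> \<Longrightarrow>
    (a \<oplus>\<^bsub>A\<^esub> b) \<otimes>\<^bsub>A\<^esub> c = a \<otimes>\<^bsub>A\<^esub> c \<oplus>\<^bsub>A\<^esub> b \<otimes>\<^bsub>A\<^esub> c"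
  using linear_map_mult_right unfolding linear_map_def by blast

text \<open>In the argument that \<open>f\<close> acts on, the product is \<open>f\<close> followed
  by multiplication by a fixed element; in the other it is multiplication by a fixed value of
  \<open>f\<close>. This will be used with \<open>f\<close> equal to
  \<open>P \<omega>\<close>.\<close>

lemma
  assumes "linear_map K A A f"
  shows bilinear_product_mult_map_right: "bilinear_product K A (\<lambda>a b. a \<otimes>\<^bsub>A\<^esub> f b)"
    and bilinear_product_mult_map_left: "bilinear_product K A (\<lambda>a b. f a \<otimes>\<^bsub>A\<^esub> b)"
proof -
  have f_closed: "f a \<in> carrier A" if "a \<in> carrier A" for a
    using assms that unfolding linear_map_def by blast
  show "bilinear_product K A (\<lambda>a b. a \<otimes>\<^bsub>A\<^esub> f b)" "bilinear_product K A (\<lambda>a b. f a \<otimes>\<^bsub>A\<^esub> b)"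
    unfolding bilinear_product_def
    using linear_map_mult_left linear_map_mult_right f_closed
      linear_map_compose[OF assms linear_map_mult_left]
      linear_map_compose[OF assms linear_map_mult_right]
    by auto
qed

end

theorem proposition2p11:
  fixes K :: "('k, 'm) ring_scheme"
    and A :: "('k, 'a, 'n) module_scheme"
    and \<Omega> :: "'w set"
    and larrow rarrow ltri rtri :: "'w \<Rightarrow> 'w \<Rightarrow> 'w"
    and P :: "'w \<Rightarrow> 'a \<Rightarrow> 'a"
  assumes "Omega_Rota_Baxter_algebra K A \<Omega> larrow rarrow ltri rtri P"
  shows "Omega_dendriform_algebra K A \<Omega> larrow rarrow ltri rtri
           (\<lambda>\<omega> a b. a \<otimes>\<^bsub>A\<^esub> P \<omega> b) (\<lambda>\<omega> a b. P \<omega> a \<otimes>\<^bsub>A\<^esub> b)"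
proof -
  interpret Omega_Rota_Baxter_algebra K A \<Omega> larrow rarrow ltri rtri P
    by (fact assms)
  have P_closed: "P \<omega> a \<in> carrier A" if "\<omega> \<in> \<Omega>" "a \<in> carrier A" for \<omega> a
    using P_linear that unfolding linear_map_def by blast
  note closed = P_closed alg_mult_closed larrow_closed rarrow_closed ltri_closed rtri_closed
  show ?thesis
  proof unfold_locales
    fix \<alpha> \<beta> a b c
    assume mem: "\<alpha> \<in> \<Omega>" "\<beta> \<in> \<Omega>" "a \<in> carrier A" "b \<in> carrier A" "c \<in> carrier A"
    show "(a \<otimes>\<^bsub>A\<^esub> P \<alpha> b) \<otimes>\<^bsub>A\<^esub> P \<beta> c =
        a \<otimes>\<^bsub>A\<^esub> P (larrow \<alpha> \<beta>) (b \<otimes>\<^bsub>A\<^esub> P (ltri \<alpha> \<beta>) c)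
        \<oplus>\<^bsub>A\<^esub> a \<otimes>\<^bsub>A\<^esub> P (rarrow \<alpha> \<beta>) (P (rtri \<alpha> \<beta>) b \<otimes>\<^bsub>A\<^esub> c)"
      \<comment> \<open>\<open>Rota_Baxter\<close> gives the \<open>rarrow\<close> term first, the
        dendriform axiom the \<open>larrow\<close> term; \<open>M.a_comm\<close> swaps them.\<close>
      using mem by (simp add: mult_assoc Rota_Baxter alg_distrib_left closed M.a_comm)
    show "P \<alpha> a \<otimes>\<^bsub>A\<^esub> (b \<otimes>\<^bsub>A\<^esub> P \<beta> c) = (P \<alpha> a \<otimes>\<^bsub>A\<^esub> b) \<otimes>\<^bsub>A\<^esub> P \<beta> c"
      using mem by (simp add: mult_assoc closed)
    show "P \<alpha> a \<otimes>\<^bsub>A\<^esub> (P \<beta> b \<otimes>\<^bsub>A\<^esub> c) =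
        P (rarrow \<alpha> \<beta>) (P (rtri \<alpha> \<beta>) a \<otimes>\<^bsub>A\<^esub> b) \<otimes>\<^bsub>A\<^esub> c
        \<oplus>\<^bsub>A\<^esub> P (larrow \<alpha> \<beta>) (a \<otimes>\<^bsub>A\<^esub> P (ltri \<alpha> \<beta>) b) \<otimes>\<^bsub>A\<^esub> c"
      using mem
      \<comment> \<open>Associativity is reversed here to bracket \<open>P \<alpha> a\<close> with
        \<open>P \<beta> b\<close>; the summands already come in the right order.\<close>
      by (simp add: mult_assoc[symmetric] Rota_Baxter alg_distrib_right closed)
  \<comment> \<open>What remains is bilinearity of the two products for each index.\<close>
  qed (simp_all add: bilinear_product_mult_map_left bilinear_product_mult_map_right P_linear)
qed

end
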